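(* Let $A=(a_{ij})$ be a real $m\times n$ matrix with $m\ge n$ and $\operatorname{rank}(A)=r=\min\{m,n\}=n$, and let $\varepsilon=(\varepsilon_1,\dots,\varepsilon_r)$ be a signature. Then $A$ is ASSR with signature $\varepsilon$ if and only if $A$ is type-I or type-II staircase and every nontrivial minor with consecutive rows and columns satisfies $$\varepsilon_k\det A[\alpha|\beta]>0,\qquad \alpha\in Q^0_{k,m},\ \beta\in Q^0_{k,n},\ k\le n.$$
   Context: $Q_{k,n}$ is the set of strictly increasing sequences of $k$ natural numbers not greater than $n$, and $Q^0_{k,n}\subseteq Q_{k,n}$ is the subset of sequences of $k$ consecutive integers. For $\alpha\in Q_{k,m}$, $\beta\in Q_{k,n}$, $A[\alpha|\beta]$ is the $k\times k$ submatrix with rows $\alpha_1,\dots,\alpha_k$ and columns $\beta_1,\dots,\beta_k$. An $m\times n$ real matrix $A=(a_{ij})$ is type-I staircase if: (i) $a_{ii}\neq 0$ for all $i\le\min\{m,n\}$; (ii) if $i>j$ and $a_{ij}=0$ then $a_{kl}=0$ for all $k\ge i$, $l\le j$; (iii) if $i<j$ and $a_{ij}=0$ then $a_{kl}=0$ for all $k\le i$, $l\ge j$. With $P_m$ the $m\times m$ backward identity matrix (entries $1$ where $i+j=m+1$, $0$ elsewhere), $A$ is type-II staircase if $P_mA$ is type-I staircase. A submatrix $A[\alpha|\beta]$ is nontrivial if $a_{\alpha_i,\beta_i}\ne0$ for all $i$; its determinant is then a nontrivial minor. A signature is a vector with entries $\pm1$. A matrix $A$ with $\operatorname{rank}(A)=r=\min\{m,n\}$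 is ASSR with signature $\varepsilon=(\varepsilon_1,\dots,\varepsilon_r)$ if it is type-I or type-II staircase and every nontrivial minor satisfies $\varepsilon_k\det A[\alpha|\beta]>0$ for all $\alpha\in Q_{k,m}$, $\beta\in Q_{k,n}$, $k\le r$. *)

theory Defs
  imports "Jordan_Normal_Form.DL_Rank"
begin

text \<open>
  All matrix, sequence and signature indices are shifted by one to match the 0-based entries
  \<open>A $$ (i, j)\<close>: the index set \<open>{1, ..., n}\<close> becomes \<open>{0, ..., n - 1}\<close>, and the
  sign \<open>\<epsilon>\<^sub>k\<close> belonging to the minors of order \<open>k\<close> is \<open>\<epsilon> $ (k - 1)\<close>.
\<close>

definition Q :: "nat \<Rightarrow> nat \<Rightarrow> nat list set" where
  "Q k n = {\<alpha>. length \<alpha> = k \<and> sorted_wrt (<) \<alpha> \<and> set \<alpha> \<subseteq> {..<n}}"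

definition Q0 :: "nat \<Rightarrow> nat \<Rightarrow> nat list set" where
  "Q0 k n = {\<alpha> \<in> Q k n. \<forall>i. i + 1 < k \<longrightarrow> \<alpha> ! (i + 1) = \<alpha> ! i + 1}"

definition sub_mat :: "'a mat \<Rightarrow> nat list \<Rightarrow> nat list \<Rightarrow> 'a mat" where
  "sub_mat A \<alpha> \<beta> = mat (length \<alpha>) (length \<beta>) (\<lambda>(i, j). A $$ (\<alpha> ! i, \<beta> ! j))"

definition type1_staircase :: "real mat \<Rightarrow> bool" where
  "type1_staircase A \<longleftrightarrow>
     (\<forall>i < min (dim_row A) (dim_col A). A $$ (i, i) \<noteq> 0) \<and>
     (\<forall>i < dim_row A. \<forall>j < dim_col A. i > j \<and> A $$ (i, j) = 0 \<longrightarrow>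
        (\<forall>k < dim_row A. \<forall>l < dim_col A. k \<ge> i \<and> l \<le> j \<longrightarrow> A $$ (k, l) = 0)) \<and>
     (\<forall>i < dim_row A. \<forall>j < dim_col A. i < j \<and> A $$ (i, j) = 0 \<longrightarrow>
        (\<forall>k < dim_row A. \<forall>l < dim_col A. k \<le> i \<and> l \<ge> j \<longrightarrow> A $$ (k, l) = 0))"

text \<open>The condition \<open>i + j = m + 1\<close> on 1-based indices reads \<open>i + j + 1 = m\<close> here.\<close>

definition backward_identity :: "nat \<Rightarrow> real mat" where
  "backward_identity m = mat m m (\<lambda>(i, j). if i + j + 1 = m then 1 else 0)"

definition type2_staircase :: "real mat \<Rightarrow> bool" where
  "type2_staircase A \<longleftrightarrow> type1_staircase (backward_identity (dim_row A) * A)"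

text \<open>
  Nontriviality refers to the main diagonal of the submatrix for both staircase types. The
  definition is meant for \<open>\<alpha>\<close> and \<open>\<beta>\<close> of equal length.
\<close>

definition nontrivial_sub_mat :: "real mat \<Rightarrow> nat list \<Rightarrow> nat list \<Rightarrow> bool" where
  "nontrivial_sub_mat A \<alpha> \<beta> \<longleftrightarrow> (\<forall>i < length \<alpha>. A $$ (\<alpha> ! i, \<beta> ! i) \<noteq> 0)"

definition is_signature :: "nat \<Rightarrow> real vec \<Rightarrow> bool" where
  "is_signature r \<epsilon> \<longleftrightarrow> \<epsilon> \<in> carrier_vec r \<and> (\<forall>i < r. \<epsilon> $ i = 1 \<or> \<epsilon> $ i = - 1)"

definition ASSR :: "real mat \<Rightarrow> real vec \<Rightarrow> bool" where
  "ASSR A \<epsilon> \<longleftrightarrow>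
     (let m = dim_row A; n = dim_col A; r = min m n in
        vec_space.rank m A = r \<and> is_signature r \<epsilon> \<and>
        (type1_staircase A \<or> type2_staircase A) \<and>
        (\<forall>k \<in> {1..r}. \<forall>\<alpha> \<in> Q k m. \<forall>\<beta> \<in> Q k n.
           nontrivial_sub_mat A \<alpha> \<beta> \<longrightarrow> \<epsilon> $ (k - 1) * det (sub_mat A \<alpha> \<beta>) > 0))"

end

theory Submission
  imports Defs
begin

text \<open>
  Induction on the order \<open>k\<close>, for type-I staircase matrices: trivial minors vanish. If a nontrivial
  minor has a zero next to its diagonal, it is block triangular and factors into nontrivial minors
  of smaller order. Otherwise every gap in its rows or columns can be filled without destroying
  nontriviality, and a three-term determinantal identity reduces the sign to minors with smaller
  dispersion, down to consecutive rows and columns. In the block triangular case one needs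
  \<open>\<epsilon>\<^sub>k = \<epsilon>\<^sub>s \<epsilon>\<^sub>k\<^sub>-\<^sub>s\<close>; restricting the minor to fewer indices around the zero gives
  \<open>\<epsilon>\<^sub>j = \<epsilon>\<^sub>1\<^sup>j\<close> for all \<open>j < k\<close>, and a consecutive block triangular minor gives it for \<open>j = k\<close>.
  For type-II matrices a nontrivial submatrix spans a rectangle without zeros, to which the type-I
  case applies.
\<close>

section \<open>Minors of a doubly indexed family\<close>

text \<open>Rows and columns are functions rather than lists: only their values below
  \<open>k\<close> count, and deleting, inserting or shifting an index becomes composition.\<close>

definition minor :: "(nat \<Rightarrow> nat \<Rightarrow> 'a :: comm_ring_1) \<Rightarrow> nat \<Rightarrow> (nat \<Rightarrow> nat) \<Rightarrow> (nat \<Rightarrow> nat) \<Rightarrow> 'a" where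
  "minor a k f g = det (mat k k (\<lambda>(i, j). a (f i) (g j)))"

lemma minor_cong:
  assumes "\<And>i j. i < k \<Longrightarrow> j < k \<Longrightarrow> a (f i) (g j) = a' (f' i) (g' j)"
  shows "minor a k f g = minor a' k f' g'"
  unfolding minor_def by (intro arg_cong[of _ _ det] cong_mat) (auto simp: assms)

lemma minor_transpose: "minor (\<lambda>i j. a j i) k g f = minor a k f g"
proof -
  have "mat k k (\<lambda>(i, j). a (f j) (g i)) = transpose_mat (mat k k (\<lambda>(i, j). a (f i) (g j)))"
    by (intro eq_matI) auto
  then show ?thesis
    unfolding minor_def by (simp add: det_transpose[of _ k])
qed

lemma minor_equal_columns:
  assumes "i < k" "j < k" "i \<noteq> j" "g i = g j"
  shows "minor a k f g = 0"
  unfolding minor_def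
  by (rule det_identical_columns[OF _ assms(3,1,2)]) (use assms in \<open>auto intro!: eq_vecI\<close>)

lemma minor_expand_row:
  assumes "p < Suc k"
  shows "minor a (Suc k) f g =
    (\<Sum>j<Suc k. (-1) ^ (p + j) * a (f p) (g j) * minor a k (f \<circ> insert_index p) (g \<circ> insert_index j))"
proof -
  let ?B = "mat (Suc k) (Suc k) (\<lambda>(i, j). a (f i) (g j))"
  have "det ?B = (\<Sum>j<Suc k. ?B $$ (p, j) * cofactor ?B p j)"
    by (rule laplace_expansion_row) (use assms in auto)
  also have "\<dots> = (\<Sum>j<Suc k. (-1) ^ (p + j) * a (f p) (g j) *
      minor a k (f \<circ> insert_index p) (g \<circ> insert_index j))"
  proof (rule sum.cong[OF refl])
    fix j assume j: "j \<in> {..<Suc k}"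
    have "mat_delete ?B p j = mat k k (\<lambda>(i, j'). a ((f \<circ> insert_index p) i) ((g \<circ> insert_index j) j'))"
      using assms j by (intro eq_matI) (auto simp: mat_delete_def insert_index_def)
    then show "?B $$ (p, j) * cofactor ?B p j = (-1) ^ (p + j) * a (f p) (g j) *
        minor a k (f \<circ> insert_index p) (g \<circ> insert_index j)"
      using assms j by (simp add: cofactor_def minor_def)
  qed
  finally show ?thesis by (simp add: minor_def)
qed

lemma minor_expand_column:
  assumes "q < Suc k"
  shows "minor a (Suc k) f g =
    (\<Sum>i<Suc k. (-1) ^ (i + q) * a (f i) (g q) * minor a k (f \<circ> insert_index i) (g \<circ> insert_index q))"
  using minor_expand_row[OF assms, of "\<lambda>i j. a j i" g f]
  by (simp add: minor_transpose[of a] add.commute del: sum.lessThan_Suc)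

text \<open>With a copy of row \<open>f p\<close> put in front of the rows \<open>f\<close>, the
  determinant has two equal rows; its expansion along the new row is this sum.\<close>

lemma minors_linear_relation:
  assumes "p < Suc k"
  shows "(\<Sum>j<Suc (Suc k). (-1) ^ j * a (f p) (c j) * minor a (Suc k) f (c \<circ> insert_index j)) = 0"
proof -
  let ?f = "case_nat (f p) f"
  have "minor a (Suc (Suc k)) ?f c = 0"
    using minor_equal_columns[of 0 "Suc (Suc k)" "Suc p" ?f "\<lambda>i j. a j i" c] assms
    by (simp add: minor_transpose[of a])
  moreover have "?f \<circ> insert_index 0 = f"
    by (auto simp: fun_eq_iff insert_index_def)
  ultimately show ?thesis
    using minor_expand_row[of 0 "Suc k" a ?f c] by (simp del: sum.lessThan_Suc)
qed

text \<open>
  A Pluecker relation: a linear relation between the \<open>k + 2\<close> columns is fed into the linear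
  functional that inserts a column into the minor with rows \<open>f \<circ> Suc\<close> and columns
  \<open>c 1, \<dots>, c k\<close> without \<open>c t\<close>.
\<close>

lemma three_term_relation:
  assumes "1 \<le> t" "t \<le> k"
  shows "minor a (Suc k) f (c \<circ> insert_index t) * minor a k (f \<circ> Suc) (c \<circ> Suc) =
    minor a (Suc k) f c * minor a k (f \<circ> Suc) (c \<circ> Suc \<circ> insert_index (t - 1)) +
    minor a (Suc k) f (c \<circ> Suc) * minor a k (f \<circ> Suc) (c \<circ> insert_index t)"
proof -
  obtain l where k: "k = Suc l" using assms by (cases k) auto
  define w where "w = f \<circ> Suc"
  define \<tau> where "\<tau> = c \<circ> Suc \<circ> insert_index (t - 1)"
  \<comment> \<open>\<open>K x\<close> is the Laplace expansion along column \<open>x\<close> of the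
    minor with rows \<open>w\<close> that has \<open>x\<close> in front of the columns
    \<open>\<tau>\<close>. Inserting \<open>x\<close> at position \<open>q\<close> instead costs the
    factor \<open>(-1) ^ q\<close>, as \<open>ins\<close> records.\<close>
  define K where "K x = (\<Sum>i<k. (-1) ^ i * a (w i) x * minor a l (w \<circ> insert_index i) \<tau>)" for x
  define M where "M j = minor a (Suc k) f (c \<circ> insert_index j)" for j
  have ins: "minor a k w h = (-1) ^ q * K (h q)"
    if "q < k" "\<And>j. j < l \<Longrightarrow> h (insert_index q j) = \<tau> j" for h q
  proof -
    have "minor a l (w \<circ> insert_index i) (h \<circ> insert_index q) = minor a l (w \<circ> insert_index i) \<tau>" for i
      using that by (intro minor_cong) auto
    then show ?thesis
      using minor_expand_column[of q l a w h] that(1)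
      by (simp add: k K_def sum_distrib_left power_add mult.assoc mult.left_commute del: sum.lessThan_Suc)
  qed
  have Kt: "minor a k w (c \<circ> Suc) = (-1) ^ (t - 1) * K (c t)"
    using ins[of "t - 1" "c \<circ> Suc"] assms by (simp add: \<tau>_def)
  have Klast: "minor a k w \<tau> = (-1) ^ l * K (c (Suc k))"
  proof -
    have "\<tau> l = c (Suc k)" using assms k by (auto simp: \<tau>_def insert_index_def)
    then show ?thesis using ins[of l \<tau>] k by (simp add: insert_index_def)
  qed
  have K0: "minor a k w (c \<circ> insert_index t) = K (c 0)"
  proof -
    have "insert_index t (Suc j) = Suc (insert_index (t - 1) j)" for j
      using assms by (auto simp: insert_index_def)
    then show ?thesis
      using ins[of 0 "c \<circ> insert_index t"] assms by (simp add: \<tau>_def)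
  qed
  \<comment> \<open>Such a \<open>c j\<close> is already a column of \<open>\<tau>\<close>, so
    inserting it produces two equal columns. Its position in \<open>\<tau>\<close> is
    \<open>j - 1\<close> before the omitted \<open>c t\<close> and \<open>j - 2\<close> after
    it.\<close>
  have K_zero: "K (c j) = 0" if "1 \<le> j" "j \<le> k" "j \<noteq> t" for j
  proof -
    define i where "i = (if j < t then j - 1 else j - 2)"
    have "Suc (Suc (j - 2)) = j" if "\<not> j < t"
      using that assms \<open>j \<noteq> t\<close> by simp
    then have i: "i < l" "\<tau> i = c j"
      using that assms k by (auto simp: i_def \<tau>_def insert_index_def)
    have "K (c j) = minor a k w (case_nat (c j) \<tau>)"
      using ins[of 0 "case_nat (c j) \<tau>"] k by (simp add: insert_index_def)
    also have "\<dots> = 0"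
      by (rule minor_equal_columns[of 0 _ "Suc i"]) (use i k in auto)
    finally show ?thesis .
  qed
  have "(\<Sum>j<Suc (Suc k). (-1) ^ j * M j * K (c j)) =
      (\<Sum>i<k. (-1) ^ i * minor a l (w \<circ> insert_index i) \<tau> *
        (\<Sum>j<Suc (Suc k). (-1) ^ j * a (w i) (c j) * M j))"
    unfolding K_def sum_distrib_left by (subst sum.swap) (simp add: mult_ac)
  also have "\<dots> = 0"
    using minors_linear_relation[of "Suc _" k a f c]
    by (intro sum.neutral ballI) (simp add: w_def M_def del: sum.lessThan_Suc)
  finally have "0 = (\<Sum>j<Suc (Suc k). (-1) ^ j * M j * K (c j))" ..
  also have "\<dots> = (\<Sum>j\<in>{0, t, Suc k}. (-1) ^ j * M j * K (c j))"
    using assms K_zero by (intro sum.mono_neutral_right) (auto simp: less_Suc_eq_le le_Suc_eq)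
  also have "\<dots> = M 0 * K (c 0) + (-1) ^ t * M t * K (c t) + (-1) ^ Suc k * M (Suc k) * K (c (Suc k))"
    using assms by simp
  also have "(-1) ^ t * M t * K (c t) = - (M t * minor a k w (c \<circ> Suc))"
    using assms by (cases t) (auto simp: Kt)
  also have "(-1) ^ Suc k * M (Suc k) * K (c (Suc k)) = M (Suc k) * minor a k w \<tau>"
    unfolding Klast by (simp add: k)
  also have "M 0 = minor a (Suc k) f (c \<circ> Suc)"
    unfolding M_def by (rule minor_cong) (simp add: insert_index_def)
  also have "M (Suc k) = minor a (Suc k) f c"
    unfolding M_def by (rule minor_cong) (simp add: insert_index_def)
  finally have "0 = minor a (Suc k) f (c \<circ> Suc) * minor a k (f \<circ> Suc) (c \<circ> insert_index t) +
      - (minor a (Suc k) f (c \<circ> insert_index t) * minor a k (f \<circ> Suc) (c \<circ> Suc)) +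
      minor a (Suc k) f c * minor a k (f \<circ> Suc) (c \<circ> Suc \<circ> insert_index (t - 1))"
    unfolding K0[symmetric] M_def w_def \<tau>_def .
  moreover have "X = Y + Z" if "0 = Z + - X + Y" for X Y Z :: 'a
  proof -
    have "X + 0 = Y + Z" by (subst that) simp
    then show ?thesis by simp
  qed
  ultimately show ?thesis by blast
qed

section \<open>Block triangular minors\<close>

lemma minor_block_lower:
  fixes a :: "nat \<Rightarrow> nat \<Rightarrow> 'a :: idom"
  assumes "s \<le> k" "\<And>i j. i < s \<Longrightarrow> s \<le> j \<Longrightarrow> j < k \<Longrightarrow> a (f i) (g j) = 0"
  shows "minor a k f g = minor a s f g * minor a (k - s) (\<lambda>i. f (s + i)) (\<lambda>i. g (s + i))"
proof -
  let ?A3 = "mat (k - s) s (\<lambda>(i, j). a (f (s + i)) (g j))"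
  have "mat k k (\<lambda>(i, j). a (f i) (g j)) =
      four_block_mat (mat s s (\<lambda>(i, j). a (f i) (g j))) (0\<^sub>m s (k - s)) ?A3
        (mat (k - s) (k - s) (\<lambda>(i, j). a (f (s + i)) (g (s + j))))"
    using assms by (intro eq_matI) auto
  then show ?thesis
    unfolding minor_def by (simp add: det_four_block_mat_upper_right_zero[where n = s and m = "k - s"])
qed

lemma minor_block_upper:
  fixes a :: "nat \<Rightarrow> nat \<Rightarrow> 'a :: idom"
  assumes "s \<le> k" "\<And>i j. j < s \<Longrightarrow> s \<le> i \<Longrightarrow> i < k \<Longrightarrow> a (f i) (g j) = 0"
  shows "minor a k f g = minor a s f g * minor a (k - s) (\<lambda>i. f (s + i)) (\<lambda>i. g (s + i))"
  using minor_block_lower[of s k "\<lambda>i j. a j i" g f] assms by (simp add: minor_transpose[of a])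

lemma minor_zero_column:
  assumes "q < k" "\<And>i. i < k \<Longrightarrow> a (f i) (g q) = 0"
  shows "minor a k f g = 0"
proof -
  obtain l where "k = Suc l" using assms(1) by (cases k) auto
  then show ?thesis
    using minor_expand_column[of q l a f g] assms by (simp del: sum.lessThan_Suc)
qed

section \<open>Staircase patterns\<close>

definition index_seq :: "nat \<Rightarrow> nat \<Rightarrow> (nat \<Rightarrow> nat) \<Rightarrow> bool" where
  "index_seq k m f \<longleftrightarrow> strict_mono_on {..<k} f \<and> (\<forall>i<k. f i < m)"

definition nontrivial :: "(nat \<Rightarrow> nat \<Rightarrow> 'a :: zero) \<Rightarrow> nat \<Rightarrow> (nat \<Rightarrow> nat) \<Rightarrow> (nat \<Rightarrow> nat) \<Rightarrow> bool" where
  "nontrivial a k f g \<longleftrightarrow> (\<forall>i<k. a (f i) (g i) \<noteq> 0)"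

lemma index_seq_lessD: "index_seq k m f \<Longrightarrow> i < j \<Longrightarrow> j < k \<Longrightarrow> f i < f j"
  unfolding index_seq_def by (auto intro: strict_mono_onD[of "{..<k}"])

lemma index_seq_leD: "index_seq k m f \<Longrightarrow> i \<le> j \<Longrightarrow> j < k \<Longrightarrow> f i \<le> f j"
  using index_seq_lessD[of k m f i j] by (cases "i = j") auto

lemma index_seq_boundD: "index_seq k m f \<Longrightarrow> i < k \<Longrightarrow> f i < m"
  unfolding index_seq_def by auto

lemma index_seqI:
  assumes "\<And>i. Suc i < k \<Longrightarrow> f i < f (Suc i)" "k > 0 \<Longrightarrow> f (k - 1) < m"
  shows "index_seq k m f"
proof -
  have less: "f i < f j" if "i < j" "j < k" for i j
    using that
  proof (induction j)
    case (Suc j)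
    then show ?case
      using assms(1)[of j] by (cases "i = j") auto
  qed simp
  have "f i < m" if "i < k" for i
    using less[of i "k - 1"] assms(2) that by (cases "i = k - 1") force+
  then show ?thesis
    unfolding index_seq_def by (auto intro!: strict_mono_onI less)
qed

lemma index_seq_distance:
  assumes "index_seq k m f" "i \<le> j" "j < k"
  shows "f i + (j - i) \<le> f j"
  using assms(2,3)
proof (induction j)
  case (Suc j)
  show ?case
  proof (cases "i = Suc j")
    case False
    then show ?thesis
      using Suc index_seq_lessD[OF assms(1), of j "Suc j"] by simp
  qed simp
qed simp

lemma index_seq_shift:
  assumes "index_seq k m f" "r + j \<le> k"
  shows "index_seq j m (\<lambda>i. f (r + i))"
  using assms by (auto intro!: index_seqI index_seq_lessD[OF assms(1)] index_seq_boundD[OF assms(1)])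

text \<open>Only the larger row and column index of each zero condition is bounded, since this
  bounds the other one. The conditions are exchanged by transposition, so each later argument is
  carried out on one side of the diagonal only.\<close>

locale staircase =
  fixes a :: "nat \<Rightarrow> nat \<Rightarrow> real" and m n :: nat
  assumes diag: "i < m \<Longrightarrow> i < n \<Longrightarrow> a i i \<noteq> 0"
    and low: "k < m \<Longrightarrow> j < n \<Longrightarrow> j < i \<Longrightarrow> a i j = 0 \<Longrightarrow> i \<le> k \<Longrightarrow> l \<le> j \<Longrightarrow> a k l = 0"
    and up: "i < m \<Longrightarrow> l < n \<Longrightarrow> i < j \<Longrightarrow> a i j = 0 \<Longrightarrow> k \<le> i \<Longrightarrow> j \<le> l \<Longrightarrow> a k l = 0"
begin

lemma staircase_transpose: "staircase (\<lambda>i j. a j i) n m"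
proof
  show "a i i \<noteq> 0" if "i < n" "i < m" for i
    using diag that by blast
  show "a l k = 0" if "k < n" "j < m" "j < i" "a j i = 0" "i \<le> k" "l \<le> j" for k j i l
    using up that by blast
  show "a l k = 0" if "i < n" "l < m" "i < j" "a j i = 0" "k \<le> i" "j \<le> l" for i l j k
    using low that by blast
qed

text \<open>A zero at column \<open>p\<close> would spread along the row away from the diagonal: to
  \<open>y\<close> if it lies left of the diagonal, to \<open>z\<close> if it lies right of
  it.\<close>

lemma row_interval:
  assumes "x < m" "z < n" "a x y \<noteq> 0" "a x z \<noteq> 0" "y \<le> p" "p \<le> z"
  shows "a x p \<noteq> 0"
  using assms diag[of x] low[of x p x y] up[of x z p x] by (cases p x rule: linorder_cases) auto

lemma zero_block_below:
  assumes "index_seq k m f" "index_seq k n g" "p < k" "q < k" "g q < f p" "a (f p) (g q) = 0"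
    and "p \<le> i" "i < k" "j \<le> q"
  shows "a (f i) (g j) = 0"
  using assms low[of "f i" "g q" "f p" "g j"] index_seq_leD[of k m f p i] index_seq_leD[of k n g j q]
    index_seq_boundD[of k m f i] index_seq_boundD[of k n g q] by auto

lemma zero_block_above:
  assumes "index_seq k m f" "index_seq k n g" "p < k" "q < k" "f p < g q" "a (f p) (g q) = 0"
    and "i \<le> p" "q \<le> j" "j < k"
  shows "a (f i) (g j) = 0"
  using assms up[of "f p" "g j" "g q" "f i"] index_seq_leD[of k m f i p] index_seq_leD[of k n g q j]
    index_seq_boundD[of k m f p] index_seq_boundD[of k n g j] by auto

text \<open>The zero spreads to all rows from \<open>p\<close> on and all columns up to
  \<open>p\<close>. Hence the minor is block triangular, and its second block starts with a zero
  column.\<close>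

lemma minor_trivial_below:
  assumes "index_seq k m f" "index_seq k n g" "p < k" "g p < f p" "a (f p) (g p) = 0"
  shows "minor a k f g = 0"
proof -
  have "minor a k f g = minor a p f g * minor a (k - p) (\<lambda>i. f (p + i)) (\<lambda>i. g (p + i))"
    by (rule minor_block_upper) (use assms in \<open>auto intro: zero_block_below[of k f g p p]\<close>)
  also have "minor a (k - p) (\<lambda>i. f (p + i)) (\<lambda>i. g (p + i)) = 0"
    by (rule minor_zero_column[of 0]) (use assms in \<open>auto intro: zero_block_below[of k f g p p]\<close>)
  finally show ?thesis by simp
qed

end

lemma (in staircase) minor_trivial:
  assumes "index_seq k m f" "index_seq k n g" "\<not> nontrivial a k f g"
  shows "minor a k f g = 0"
proof -
  interpret T: staircase "\<lambda>i j. a j i" n m by (rule staircase_transpose)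
  obtain p where p: "p < k" "a (f p) (g p) = 0"
    using assms(3) by (auto simp: nontrivial_def)
  then have "f p \<noteq> g p"
    using diag[of "f p"] index_seq_boundD[OF assms(1)] index_seq_boundD[OF assms(2)] by metis
  then show ?thesis
    using minor_trivial_below[of k f g p] T.minor_trivial_below[of k g f p] assms p
    by (cases "g p < f p") (auto simp: minor_transpose[of a])
qed

section \<open>Splitting minors at a zero next to their diagonal\<close>

definition splits_at :: "(nat \<Rightarrow> nat \<Rightarrow> 'a :: zero) \<Rightarrow> (nat \<Rightarrow> nat) \<Rightarrow> (nat \<Rightarrow> nat) \<Rightarrow> nat \<Rightarrow> bool" where
  "splits_at a f g s \<longleftrightarrow> a (f s) (g (Suc s)) = 0 \<or> a (f (Suc s)) (g s) = 0"

text \<open>A zero below the diagonal of \<open>a\<close> would spread left within row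
  \<open>f s\<close> to the entry in column \<open>g s\<close>, which is nonzero by
  nontriviality.\<close>

lemma (in staircase) zero_above_diagonal:
  assumes "index_seq k m f" "index_seq k n g" "nontrivial a k f g" "Suc s < k" "a (f s) (g (Suc s)) = 0"
  shows "f s < g (Suc s)"
proof (rule ccontr)
  assume "\<not> f s < g (Suc s)"
  moreover have "f s \<noteq> g (Suc s)"
    using diag[of "f s"] assms index_seq_boundD[OF assms(1), of s]
      index_seq_boundD[OF assms(2), of "Suc s"] by auto
  ultimately have "a (f s) (g s) = 0"
    using zero_block_below[of k f g s "Suc s" s s] assms by auto
  then show False
    using assms by (auto simp: nontrivial_def)
qed

text \<open>The zero spreads to rows up to \<open>s\<close> and columns from \<open>Suc s\<close>
  on, so the upper right block vanishes.\<close>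

lemma (in staircase) minor_split_above:
  assumes "index_seq k m f" "index_seq k n g" "nontrivial a k f g" "Suc s < k" "a (f s) (g (Suc s)) = 0"
  shows "minor a k f g =
    minor a (Suc s) f g * minor a (k - Suc s) (\<lambda>i. f (Suc s + i)) (\<lambda>i. g (Suc s + i))"
  by (rule minor_block_lower)
    (use assms zero_above_diagonal[OF assms] in \<open>auto intro: zero_block_above[of k f g s "Suc s"]\<close>)

lemma (in staircase) minor_split:
  assumes "index_seq k m f" "index_seq k n g" "nontrivial a k f g" "Suc s < k" "splits_at a f g s"
  shows "minor a k f g =
    minor a (Suc s) f g * minor a (k - Suc s) (\<lambda>i. f (Suc s + i)) (\<lambda>i. g (Suc s + i))"
proof -
  interpret T: staircase "\<lambda>i j. a j i" n m by (rule staircase_transpose)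
  show ?thesis
    using assms minor_split_above[of k f g s] T.minor_split_above[of k g f s]
    by (auto simp: splits_at_def nontrivial_def minor_transpose[of a])
qed

text \<open>
  Among the zeros above the diagonal that lie in the rectangle spanned by the minor, one closest to
  the diagonal is chosen: the diagonal just below it has no zero in the rectangle, and it is long
  enough for a window of length \<open>k\<close> next to the chosen zero.
\<close>

lemma (in staircase) consecutive_split_above:
  assumes f: "index_seq k m f" and g: "index_seq k n g" and nt: "nontrivial a k f g"
    and s: "Suc s < k" and zero: "a (f s) (g (Suc s)) = 0"
  obtains u v s' where "u + k \<le> m" "v + k \<le> n" "nontrivial a k ((+) u) ((+) v)"
    "Suc s' < k" "splits_at a ((+) u) ((+) v) s'"
proof -
  obtain l where k: "k = Suc l" using s by (cases k) auto
  define X Y where "X = f l" and "Y = g l"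
  have XY: "X < m" "Y < n" "a X Y \<noteq> 0"
    using index_seq_boundD[OF f, of l] index_seq_boundD[OF g, of l] nt k
    by (auto simp: X_def Y_def nontrivial_def)
  define P where "P d \<longleftrightarrow> (\<exists>x\<le>X. x + Suc d \<le> Y \<and> a x (x + Suc d) = 0)" for d
  define d where "d = (LEAST d. P d)"
  have fs: "f s < g (Suc s)"
    using zero_above_diagonal[OF f g nt s zero] .
  have P0: "P (g (Suc s) - f s - 1)"
    unfolding P_def using fs zero s k index_seq_leD[OF f, of s l] index_seq_leD[OF g, of "Suc s" l]
    by (intro exI[of _ "f s"]) (auto simp: X_def Y_def)
  then have "P d" unfolding d_def by (rule LeastI)
  then obtain x where x: "x \<le> X" "x + Suc d \<le> Y" "a x (x + Suc d) = 0"
    unfolding P_def by auto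
  have d_le: "d \<le> g (Suc s) - f s - 1"
    unfolding d_def using P0 by (rule Least_le)
  \<comment> \<open>These bounds say that the diagonal with offset \<open>d\<close> has at least
    \<open>k\<close> entries up to row \<open>X\<close> and column \<open>Y\<close>. For the second
    one, \<open>s \<le> f s\<close>, and at least \<open>l - Suc s\<close> columns lie beyond
    \<open>g (Suc s)\<close> up to \<open>Y\<close>.\<close>
  have l_bounds: "l \<le> X" "d + l \<le> Y"
    using index_seq_distance[OF f, of 0 l] index_seq_distance[OF f, of 0 s]
      index_seq_distance[OF g, of "Suc s" l] d_le fs s k by (auto simp: X_def Y_def)
  have on_diag: "a i (i + d) \<noteq> 0" if "i \<le> X" "i + d \<le> Y" for i
  proof (cases d)
    case 0
    then show ?thesis using diag[of i] that XY by simp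
  next
    case (Suc d')
    then have "\<not> P d'" unfolding d_def by (intro not_less_Least) simp
    then show ?thesis using that Suc unfolding P_def by auto
  qed
  \<comment> \<open>A zero in row \<open>X\<close> would spread right to the nonzero corner
    \<open>a X Y\<close>.\<close>
  have "x \<noteq> X"
    using up[of X Y "x + Suc d" X] x XY by auto
  \<comment> \<open>The window has rows \<open>u, \<dots>, u + l\<close> and columns shifted by
    \<open>d\<close>. It starts at the row of the zero, or earlier if it would otherwise leave the
    rectangle.\<close>
  define u where "u = min x (min X (Y - d) - l)"
  have u: "u \<le> x" "x + 1 \<le> u + l" "u + l \<le> X" "u + l + d \<le> Y"
    using x \<open>x \<noteq> X\<close> l_bounds s k by (auto simp: u_def min_def)
  show thesis
  proof (rule that[of u "u + d" "x - u"])
    show "nontrivial a k ((+) u) ((+) (u + d))"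
      unfolding nontrivial_def
    proof (intro allI impI)
      fix i assume "i < k"
      then show "a (u + i) (u + d + i) \<noteq> 0"
        using on_diag[of "u + i"] u k by (simp add: ac_simps)
    qed
    show "splits_at a ((+) u) ((+) (u + d)) (x - u)"
      using x u by (simp add: splits_at_def ac_simps)
  qed (use u k XY in auto)
qed

lemma (in staircase) consecutive_split:
  assumes "index_seq k m f" "index_seq k n g" "nontrivial a k f g" "Suc s < k" "splits_at a f g s"
  obtains u v s' where "u + k \<le> m" "v + k \<le> n" "nontrivial a k ((+) u) ((+) v)"
    "Suc s' < k" "splits_at a ((+) u) ((+) v) s'"
proof (cases "a (f s) (g (Suc s)) = 0")
  case True
  then show ?thesis using consecutive_split_above[of k f g s] assms that by blast
next
  case False
  interpret T: staircase "\<lambda>i j. a j i" n m by (rule staircase_transpose)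
  from False have "a (f (Suc s)) (g s) = 0" using assms(5) by (auto simp: splits_at_def)
  then obtain u v s' where "u + k \<le> n" "v + k \<le> m" "nontrivial (\<lambda>i j. a j i) k ((+) u) ((+) v)"
    "Suc s' < k" "splits_at (\<lambda>i j. a j i) ((+) u) ((+) v) s'"
    using T.consecutive_split_above[of k g f s] assms by (auto simp: nontrivial_def)
  then show ?thesis using that[of v u s'] by (auto simp: nontrivial_def splits_at_def)
qed

section \<open>Signs of nontrivial minors\<close>

definition sign_ok :: "(nat \<Rightarrow> nat \<Rightarrow> real) \<Rightarrow> nat \<Rightarrow> nat \<Rightarrow> (nat \<Rightarrow> real) \<Rightarrow> nat \<Rightarrow> bool" where
  "sign_ok a m n e k \<longleftrightarrow> (\<forall>f g. index_seq k m f \<longrightarrow> index_seq k n g \<longrightarrow> nontrivial a k f g \<longrightarrow>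
     0 < e k * minor a k f g)"

lemma sign_okD:
  "sign_ok a m n e k \<Longrightarrow> index_seq k m f \<Longrightarrow> index_seq k n g \<Longrightarrow> nontrivial a k f g \<Longrightarrow>
    0 < e k * minor a k f g"
  unfolding sign_ok_def by blast

lemma sign_ok_transpose: "sign_ok a m n e k \<Longrightarrow> sign_ok (\<lambda>i j. a j i) n m e k"
  by (auto simp: sign_ok_def nontrivial_def minor_transpose[of a])

lemma (in staircase) sign_ok_nonneg:
  assumes "sign_ok a m n e k" "index_seq k m f" "index_seq k n g"
  shows "0 \<le> e k * minor a k f g"
  using assms sign_okD[of a m n e k f g] minor_trivial[of k f g]
  by (cases "nontrivial a k f g") auto

text \<open>Filling the gap gives a sequence \<open>c\<close> of \<open>k + 2\<close> columns, to
  which the three-term relation applies. The two minors of order \<open>Suc k\<close> on its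
  right-hand side omit the last or the first column of \<open>c\<close>, so \<open>IH\<close> covers
  them; the factors of order \<open>k\<close> are controlled by \<open>ok\<close>.\<close>

lemma (in staircase) column_gap_step:
  assumes ok: "sign_ok a m n e k"
    and f: "index_seq (Suc k) m f" and g: "index_seq (Suc k) n g" and nt: "nontrivial a (Suc k) f g"
    and unsplit: "\<And>s. s < k \<Longrightarrow> \<not> splits_at a f g s"
    and t: "1 \<le> t" "t \<le> k" and gap: "Suc (g (t - 1)) < g t"
    and IH: "\<And>h. index_seq (Suc k) n h \<Longrightarrow> nontrivial a (Suc k) f h \<Longrightarrow>
      h k - h 0 < g k - g 0 \<Longrightarrow> 0 < e (Suc k) * minor a (Suc k) f h"
  shows "0 < e (Suc k) * minor a (Suc k) f g"
proof -
  define c where "c j = (if j < t then g j else if j = t then Suc (g (t - 1)) else g (j - 1))" for j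
  have c_step: "c j < c (Suc j)" if "j < Suc k" for j
    using that gap t index_seq_lessD[OF g, of j "Suc j"] index_seq_lessD[OF g, of "j - 1" j]
    by (auto simp: c_def less_Suc_eq)
  have c_bound: "c j < n" if "j < Suc (Suc k)" for j
    using that gap t index_seq_boundD[OF g, of j] index_seq_boundD[OF g, of t]
      index_seq_boundD[OF g, of "j - 1"] by (auto simp: c_def)
  have c_less: "c k < g k" "g 0 < c 1" "c 0 = g 0" "c (Suc k) = g k"
    using gap t index_seq_lessD[OF g, of "k - 1" k] index_seq_lessD[OF g, of 0 1]
    by (auto simp: c_def le_Suc_eq)
  have idx: "index_seq (Suc k) n c" "index_seq (Suc k) n (c \<circ> Suc)" "index_seq k n (c \<circ> Suc)"
      "index_seq k m (f \<circ> Suc)" "index_seq k n (g \<circ> Suc)" "index_seq k n g"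
    using index_seq_lessD[OF f] index_seq_lessD[OF g] index_seq_boundD[OF f] index_seq_boundD[OF g]
    by (auto intro!: index_seqI c_step c_bound)
  have near: "a (f i) (g (i - 1)) \<noteq> 0 \<and> a (f (i - 1)) (g i) \<noteq> 0 \<and> a (f i) (g i) \<noteq> 0"
    if "1 \<le> i" "i \<le> k" for i
    using that unsplit[of "i - 1"] nt by (auto simp: splits_at_def nontrivial_def)
  \<comment> \<open>The new column lies between \<open>g (t - 1)\<close> and \<open>g t\<close>. As
    nothing splits, rows \<open>f t\<close> and \<open>f (t - 1)\<close> are nonzero in both of
    these columns, hence also in between.\<close>
  have at_t: "a (f t) (Suc (g (t - 1))) \<noteq> 0"
    by (rule row_interval[of _ "g t" "g (t - 1)"])
      (use near[of t] t gap index_seq_boundD[OF f, of t] index_seq_boundD[OF g, of t] in auto)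
  have at_t': "a (f (t - 1)) (Suc (g (t - 1))) \<noteq> 0"
    by (rule row_interval[of _ "g t" "g (t - 1)"])
      (use near[of t] nt t gap index_seq_boundD[OF f, of "t - 1"] index_seq_boundD[OF g, of t]
        in \<open>auto simp: nontrivial_def\<close>)
  have nt_c: "nontrivial a (Suc k) f c"
    unfolding nontrivial_def
  proof (intro allI impI)
    fix i assume "i < Suc k"
    then show "a (f i) (c i) \<noteq> 0"
      using nt at_t near[of i] t by (auto simp: nontrivial_def c_def)
  qed
  have nt_c': "nontrivial a k (f \<circ> Suc) (c \<circ> Suc)"
    using nt_c by (auto simp: nontrivial_def)
  have nt_g': "nontrivial a k (f \<circ> Suc) (g \<circ> Suc)"
    using nt by (auto simp: nontrivial_def)
  have nt_c'': "nontrivial a (Suc k) f (c \<circ> Suc)"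
    unfolding nontrivial_def
  proof (intro allI impI)
    fix i assume "i < Suc k"
    then show "a (f i) ((c \<circ> Suc) i) \<noteq> 0"
      using nt at_t' near[of "Suc i"] t by (auto simp: nontrivial_def c_def)
  qed
  have gc: "g j = (c \<circ> insert_index t) j" for j
    by (auto simp: c_def insert_index_def)
  have gc': "(g \<circ> Suc) j = (c \<circ> Suc \<circ> insert_index (t - 1)) j" for j
    using t by (auto simp: c_def insert_index_def)
  have rel: "minor a (Suc k) f g * minor a k (f \<circ> Suc) (c \<circ> Suc) =
      minor a (Suc k) f c * minor a k (f \<circ> Suc) (g \<circ> Suc) +
      minor a (Suc k) f (c \<circ> Suc) * minor a k (f \<circ> Suc) g"
    using three_term_relation[OF t, of a f c] gc gc' by (metis ext)
  have "0 < e (Suc k) * minor a (Suc k) f c"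
    using IH[OF idx(1) nt_c] c_less index_seq_lessD[OF g, of 0 k] t by simp
  then have "0 < (e (Suc k) * minor a (Suc k) f c) * (e k * minor a k (f \<circ> Suc) (g \<circ> Suc))"
    using sign_okD[OF ok idx(4,5) nt_g'] by (rule mult_pos_pos)
  moreover have "0 < e (Suc k) * minor a (Suc k) f (c \<circ> Suc)"
    using IH[OF idx(2) nt_c''] c_less index_seq_lessD[OF g, of 0 k] t by simp
  \<comment> \<open>Weak positivity suffices for this summand because the other one is strictly
    positive.\<close>
  then have "0 \<le> (e (Suc k) * minor a (Suc k) f (c \<circ> Suc)) * (e k * minor a k (f \<circ> Suc) g)"
    using sign_ok_nonneg[OF ok idx(4,6)] by (intro mult_nonneg_nonneg[of "e (Suc k) * minor a (Suc k) f (c \<circ> Suc)"]) simp_all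
  ultimately have "0 < (e (Suc k) * e k) * (minor a (Suc k) f g * minor a k (f \<circ> Suc) (c \<circ> Suc))"
    unfolding rel by (simp add: algebra_simps)
  then have "0 < (e (Suc k) * minor a (Suc k) f g) * (e k * minor a k (f \<circ> Suc) (c \<circ> Suc))"
    by (simp add: ac_simps)
  then show ?thesis
    using sign_okD[OF ok idx(4,3) nt_c'] by (rule zero_less_mult_pos2)
qed

lemma sign_unique:
  assumes "0 < x * y" "0 < z * y" "x = 1 \<or> x = - 1" "z = 1 \<or> z = - 1"
  shows "x = (z :: real)"
  using assms by auto

section \<open>Induction on the order of the minors\<close>

text \<open>The bound \<open>N\<close> on the orders is kept apart from \<open>m\<close> and
  \<open>n\<close>, so that a window of a larger matrix can be treated with the signature of the
  whole matrix.\<close>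

locale signed_staircase = staircase +
  fixes e :: "nat \<Rightarrow> real" and N :: nat
  assumes signature: "1 \<le> k \<Longrightarrow> k \<le> N \<Longrightarrow> e k = 1 \<or> e k = - 1"
    and consecutive: "1 \<le> k \<Longrightarrow> k \<le> N \<Longrightarrow> u + k \<le> m \<Longrightarrow> v + k \<le> n \<Longrightarrow>
      nontrivial a k ((+) u) ((+) v) \<Longrightarrow> 0 < e k * minor a k ((+) u) ((+) v)"
begin

lemma sign_ok_consecutive:
  assumes "index_seq (Suc k) m f" "index_seq (Suc k) n g" "nontrivial a (Suc k) f g" "Suc k \<le> N"
    and "\<And>t. 1 \<le> t \<Longrightarrow> t \<le> k \<Longrightarrow> f t = Suc (f (t - 1))"
    and "\<And>t. 1 \<le> t \<Longrightarrow> t \<le> k \<Longrightarrow> g t = Suc (g (t - 1))"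
  shows "0 < e (Suc k) * minor a (Suc k) f g"
proof -
  have f: "f i = f 0 + i" if "i \<le> k" for i
    using that by (induction i) (use assms(5)[of "Suc _"] in auto)
  have g: "g i = g 0 + i" if "i \<le> k" for i
    using that by (induction i) (use assms(6)[of "Suc _"] in auto)
  have "minor a (Suc k) f g = minor a (Suc k) ((+) (f 0)) ((+) (g 0))"
    by (rule minor_cong) (metis f g less_Suc_eq_le)
  moreover have "nontrivial a (Suc k) ((+) (f 0)) ((+) (g 0))"
    using assms(3) unfolding nontrivial_def by (metis f g less_Suc_eq_le)
  ultimately show ?thesis
    using consecutive[of "Suc k" "f 0" "g 0"] assms(4) f[of k] g[of k]
      index_seq_boundD[OF assms(1), of k] index_seq_boundD[OF assms(2), of k] by auto
qed

text \<open>Inner induction on the total dispersion of rows and columns: a column gap is filled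
  directly, a row gap after transposition, and without gaps the minor is consecutive. Minors that
  split are left to the assumption \<open>split\<close>, because their sign needs a relation within
  the signature.\<close>

lemma sign_ok_step:
  assumes ok: "1 \<le> k \<Longrightarrow> sign_ok a m n e k" and k: "Suc k \<le> N"
    and split: "\<And>f g s. index_seq (Suc k) m f \<Longrightarrow> index_seq (Suc k) n g \<Longrightarrow>
      nontrivial a (Suc k) f g \<Longrightarrow> s < k \<Longrightarrow> splits_at a f g s \<Longrightarrow>
      0 < e (Suc k) * minor a (Suc k) f g"
  shows "sign_ok a m n e (Suc k)"
proof -
  interpret T: staircase "\<lambda>i j. a j i" n m by (rule staircase_transpose)
  have "0 < e (Suc k) * minor a (Suc k) f g"
    if "index_seq (Suc k) m f" "index_seq (Suc k) n g" "nontrivial a (Suc k) f g" for f g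
    using that
  proof (induction "(f k - f 0) + (g k - g 0)" arbitrary: f g rule: less_induct)
    case less
    consider (split) s where "s < k" "splits_at a f g s"
      | (col) t where "\<And>s. s < k \<Longrightarrow> \<not> splits_at a f g s" "1 \<le> t" "t \<le> k" "Suc (g (t - 1)) < g t"
      | (row) t where "\<And>s. s < k \<Longrightarrow> \<not> splits_at a f g s" "1 \<le> t" "t \<le> k" "Suc (f (t - 1)) < f t"
      | (cons) "\<And>t. 1 \<le> t \<Longrightarrow> t \<le> k \<Longrightarrow> \<not> Suc (f (t - 1)) < f t"
          "\<And>t. 1 \<le> t \<Longrightarrow> t \<le> k \<Longrightarrow> \<not> Suc (g (t - 1)) < g t"
      by blast
    then show ?case
    proof cases
      case split
      then show ?thesis using assms(3) less.prems by blast
    next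
      case col
      show ?thesis
        by (rule column_gap_step[OF ok less.prems col]) (use col less in auto)
    next
      case row
      have "0 < e (Suc k) * minor (\<lambda>i j. a j i) (Suc k) g f"
      proof (rule T.column_gap_step[OF sign_ok_transpose[OF ok] less.prems(2,1) _ _ row(2-4)])
        show "0 < e (Suc k) * minor (\<lambda>i j. a j i) (Suc k) g h"
          if "index_seq (Suc k) m h" "nontrivial (\<lambda>i j. a j i) (Suc k) g h" "h k - h 0 < f k - f 0" for h
          using that less by (simp add: minor_transpose[of a] nontrivial_def)
      qed (use row less.prems in \<open>auto simp: nontrivial_def splits_at_def\<close>)
      then show ?thesis by (simp add: minor_transpose[of a])
    next
      case cons
      show ?thesis
      proof (rule sign_ok_consecutive[OF less.prems k])
        fix t assume "1 \<le> t" "t \<le> k"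
        then show "f t = Suc (f (t - 1))" "g t = Suc (g (t - 1))"
          using cons[of t] index_seq_lessD[OF less.prems(1), of "t - 1" t]
            index_seq_lessD[OF less.prems(2), of "t - 1" t] by auto
      qed
    qed
  qed
  then show ?thesis
    by (simp add: sign_ok_def)
qed

lemma split_sign:
  assumes f: "index_seq k m f" and g: "index_seq k n g" and nt: "nontrivial a k f g"
    and s: "Suc s < k" and split: "splits_at a f g s"
    and ok: "\<And>j. 1 \<le> j \<Longrightarrow> j < k \<Longrightarrow> sign_ok a m n e j"
  shows "0 < (e (Suc s) * e (k - Suc s)) * minor a k f g"
proof -
  have "0 < e (Suc s) * minor a (Suc s) f g"
    by (rule sign_okD[OF ok])
      (use s nt index_seq_shift[OF f, of 0 "Suc s"] index_seq_shift[OF g, of 0 "Suc s"]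
        in \<open>auto simp: nontrivial_def\<close>)
  moreover have "0 < e (k - Suc s) * minor a (k - Suc s) (\<lambda>i. f (Suc s + i)) (\<lambda>i. g (Suc s + i))"
    by (rule sign_okD[OF ok])
      (use s nt index_seq_shift[OF f, of "Suc s" "k - Suc s"] index_seq_shift[OF g, of "Suc s" "k - Suc s"]
        in \<open>auto simp: nontrivial_def\<close>)
  ultimately have "0 < (e (Suc s) * minor a (Suc s) f g) *
      (e (k - Suc s) * minor a (k - Suc s) (\<lambda>i. f (Suc s + i)) (\<lambda>i. g (Suc s + i)))"
    by (rule mult_pos_pos)
  then show ?thesis
    unfolding minor_split[OF f g nt s split] by (simp add: ac_simps)
qed

lemma power_sign: "1 \<le> N \<Longrightarrow> e 1 ^ j = 1 \<or> e 1 ^ j = - 1"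
  using signature[of 1] by (metis le_refl neg_one_even_power neg_one_odd_power power_one)

text \<open>A window of length \<open>j\<close> around the zero is a nontrivial minor that still
  splits. Comparing its sign \<open>e j\<close> with the product of the signs of its two factors
  gives the power by induction on \<open>j\<close>.\<close>

lemma signature_power:
  assumes f: "index_seq k m f" and g: "index_seq k n g" and nt: "nontrivial a k f g"
    and s: "Suc s < k" and split: "splits_at a f g s" and "k \<le> N"
    and ok: "\<And>j. 1 \<le> j \<Longrightarrow> j < k \<Longrightarrow> sign_ok a m n e j"
    and "1 \<le> j" "j < k"
  shows "e j = e 1 ^ j"
  using assms(8,9)
proof (induction j rule: less_induct)
  case (less j)
  show ?case
  proof (cases "j = 1")
    case False
    then have j: "2 \<le> j" using less.prems by simp
    \<comment> \<open>The window of positions \<open>r, \<dots>, r + j - 1\<close> has to contain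
      both \<open>s\<close> and \<open>Suc s\<close> and to end before \<open>k\<close>.\<close>
    define r where "r = min s (k - j)"
    have r: "r \<le> s" "s < r + j - 1" "r + j \<le> k"
      using j less.prems s by (auto simp: r_def)
    let ?f = "\<lambda>i. f (r + i)" and ?g = "\<lambda>i. g (r + i)"
    have idx: "index_seq j m ?f" "index_seq j n ?g" "nontrivial a j ?f ?g"
      using index_seq_shift[OF f r(3)] index_seq_shift[OF g r(3)] nt r by (auto simp: nontrivial_def)
    have "splits_at a ?f ?g (s - r)"
      using split r by (simp add: splits_at_def)
    then have "0 < (e (Suc (s - r)) * e (j - Suc (s - r))) * minor a j ?f ?g"
      by (intro split_sign[OF idx] ok) (use r less.prems in auto)
    also have "e (Suc (s - r)) * e (j - Suc (s - r)) = e 1 ^ Suc (s - r) * e 1 ^ (j - Suc (s - r))"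
      using less.IH[of "Suc (s - r)"] less.IH[of "j - Suc (s - r)"] r less.prems by simp
    also have "\<dots> = e 1 ^ j"
      unfolding power_add[symmetric] using r by simp
    finally have "0 < e 1 ^ j * minor a j ?f ?g" .
    moreover have "0 < e j * minor a j ?f ?g"
      using sign_okD[OF ok idx] less.prems by simp
    ultimately show ?thesis
      using power_sign signature[of j] less.prems \<open>k \<le> N\<close> by (intro sign_unique) auto
  qed simp
qed

text \<open>
  If some nontrivial minor of order \<open>k\<close> splits, all signs of smaller order are powers of \<open>e 1\<close>,
  and a consecutive minor that splits shows the same for \<open>e k\<close>.
\<close>

lemma sign_ok_split:
  assumes f: "index_seq k m f" and g: "index_seq k n g" and nt: "nontrivial a k f g"
    and s: "Suc s < k" and split: "splits_at a f g s" and k: "k \<le> N"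
    and ok: "\<And>j. 1 \<le> j \<Longrightarrow> j < k \<Longrightarrow> sign_ok a m n e j"
  shows "0 < e k * minor a k f g"
proof -
  have sign: "0 < e 1 ^ k * minor a k f' g'"
    if "index_seq k m f'" "index_seq k n g'" "nontrivial a k f' g'" "Suc s' < k" "splits_at a f' g' s'"
    for f' g' s'
  proof -
    have "e (Suc s') = e 1 ^ Suc s'" "e (k - Suc s') = e 1 ^ (k - Suc s')"
      by (rule signature_power[OF f g nt s split k ok]; use that(4) in simp)+
    then have "e (Suc s') * e (k - Suc s') = e 1 ^ Suc s' * e 1 ^ (k - Suc s')"
      by (simp only:)
    also have "\<dots> = e 1 ^ k"
      unfolding power_add[symmetric] using that(4) by simp
    finally show ?thesis
      using split_sign[OF that ok] by (simp only:)
  qed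
  obtain u v s' where uv: "u + k \<le> m" "v + k \<le> n" "nontrivial a k ((+) u) ((+) v)"
    "Suc s' < k" "splits_at a ((+) u) ((+) v) s'"
    using consecutive_split[OF f g nt s split] by blast
  have "0 < e 1 ^ k * minor a k ((+) u) ((+) v)"
    by (rule sign[OF _ _ uv(3-5)]) (use uv s in \<open>auto intro!: index_seqI\<close>)
  moreover have "0 < e k * minor a k ((+) u) ((+) v)"
    using consecutive[OF _ k uv(1-3)] s by simp
  ultimately have "e k = e 1 ^ k"
    using power_sign signature[of k] s k by (intro sign_unique) auto
  then show ?thesis
    using sign[OF f g nt s split] by (simp only:)
qed

lemma all_nontrivial_minors_signed:
  assumes "1 \<le> k" "k \<le> N"
  shows "sign_ok a m n e k"
  using assms
proof (induction k rule: less_induct)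
  case (less k)
  then obtain l where l: "k = Suc l" by (cases k) auto
  show ?case
    unfolding l
  proof (rule sign_ok_step)
    show "0 < e (Suc l) * minor a (Suc l) f g"
      if "index_seq (Suc l) m f" "index_seq (Suc l) n g" "nontrivial a (Suc l) f g" "s < l"
        "splits_at a f g s" for f g s
      by (rule sign_ok_split[OF that(1-3) _ that(5)]) (use that less l in auto)
  qed (use less l in auto)
qed

end

section \<open>Transfer to type-I and type-II staircase matrices\<close>

lemma staircase_type1:
  assumes "A \<in> carrier_mat m n" "type1_staircase A"
  shows "staircase (\<lambda>i j. A $$ (i, j)) m n"
proof -
  have dims: "dim_row A = m" "dim_col A = n" using assms(1) by auto
  note T = assms(2)[unfolded type1_staircase_def dims]
  note T = T[THEN conjunct1, rule_format] T[THEN conjunct2, THEN conjunct1, rule_format]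
    T[THEN conjunct2, THEN conjunct2, rule_format]
  show ?thesis
  proof
    show "A $$ (i, i) \<noteq> 0" if "i < m" "i < n" for i
      using T(1)[of i] that by simp
    show "A $$ (k, l) = 0"
      if "k < m" "j < n" "j < i" "A $$ (i, j) = 0" "i \<le> k" "l \<le> j" for k j i l
    proof -
      have "i < m" "l < n" using that by linarith+
      then show ?thesis using that by (intro T(2)[of i j k l]) auto
    qed
    show "A $$ (k, l) = 0"
      if "i < m" "l < n" "i < j" "A $$ (i, j) = 0" "k \<le> i" "j \<le> l" for i l j k
    proof -
      have "j < n" "k < m" using that by linarith+
      then show ?thesis using that by (intro T(3)[of i j k l]) auto
    qed
  qed
qed

lemma backward_identity_mult:
  assumes "A \<in> carrier_mat m n" "i < m" "j < n"
  shows "(backward_identity m * A) $$ (i, j) = A $$ (m - Suc i, j)"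
proof -
  have "(backward_identity m * A) $$ (i, j) =
      (\<Sum>l = 0..<m. (if i + l + 1 = m then 1 else 0) * A $$ (l, j))"
    using assms by (auto simp: backward_identity_def scalar_prod_def intro!: sum.cong)
  also have "\<dots> = (\<Sum>l = 0..<m. if l = m - Suc i then A $$ (l, j) else 0)"
    using assms by (intro sum.cong) auto
  also have "\<dots> = A $$ (m - Suc i, j)"
    using assms by simp
  finally show ?thesis .
qed

text \<open>
  In a type-II staircase matrix the zeros fill the upper left and the lower right corner, so the
  main diagonal of a nontrivial submatrix already keeps all zeros out of the rectangle it spans.
\<close>

lemma type2_rectangle_nonzero:
  assumes A: "A \<in> carrier_mat m n" "type2_staircase A"
    and nz: "A $$ (i, j) \<noteq> 0" "A $$ (i', j') \<noteq> 0"
    and le: "i \<le> x" "x \<le> i'" "i' < m" "j \<le> y" "y \<le> j'" "j' < n"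
  shows "A $$ (x, y) \<noteq> 0"
proof
  assume zero: "A $$ (x, y) = 0"
  let ?B = "backward_identity m * A"
  have "?B \<in> carrier_mat m n"
    using A(1) by (auto simp: backward_identity_def)
  then interpret staircase "\<lambda>i j. ?B $$ (i, j)" m n
    using A by (intro staircase_type1) (auto simp: type2_staircase_def)
  have B: "?B $$ (m - Suc i, j) = A $$ (i, j)" if "i < m" "j < n" for i j
    using backward_identity_mult[OF A(1), of "m - Suc i" j] that by simp
  have bounds: "i < m" "x < m" "j < n" "y < n"
    using le by linarith+
  have Bx: "?B $$ (m - Suc x, y) = 0"
    using B[of x y] bounds zero by simp
  have nzB: "?B $$ (m - Suc i, j) \<noteq> 0" "?B $$ (m - Suc i', j') \<noteq> 0"
    using B[of i j] B[of i' j'] bounds nz le by simp_all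
  have flip: "m - Suc x \<le> m - Suc i" "m - Suc i' \<le> m - Suc x" "m - Suc x < m" "m - Suc i < m"
    using le bounds by linarith+
  show False
  \<comment> \<open>Reversing the rows puts row \<open>i'\<close> above row \<open>i\<close>. So a
    zero above the diagonal spreads to the corner \<open>(i', j')\<close>, and one below it to the
    corner \<open>(i, j)\<close>.\<close>
  proof (cases "m - Suc x" y rule: linorder_cases)
    case less
    show False
      by (rule notE[OF nzB(2) up[OF flip(3) le(6) less Bx flip(2) le(5)]])
  next
    case equal
    then show False
      using diag[OF flip(3)] bounds Bx by simp
  next
    case greater
    show False
      by (rule notE[OF nzB(1) low[OF flip(4) bounds(4) greater Bx flip(1) le(4)]])
  qed
qed

lemma index_seq_Q: "\<alpha> \<in> Q k m \<Longrightarrow> index_seq k m ((!) \<alpha>)"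
  by (rule index_seqI) (auto simp: Q_def sorted_wrt_nth_less subset_iff)

lemma upt_Q0: "u + k \<le> m \<Longrightarrow> [u..<u + k] \<in> Q0 k m"
  by (auto simp: Q0_def Q_def)

lemma nontrivial_sub_mat_eq:
  "length \<alpha> = k \<Longrightarrow> nontrivial_sub_mat A \<alpha> \<beta> \<longleftrightarrow> nontrivial (\<lambda>i j. A $$ (i, j)) k ((!) \<alpha>) ((!) \<beta>)"
  by (auto simp: nontrivial_sub_mat_def nontrivial_def)

lemma det_sub_mat:
  "length \<alpha> = k \<Longrightarrow> length \<beta> = k \<Longrightarrow> det (sub_mat A \<alpha> \<beta>) = minor (\<lambda>i j. A $$ (i, j)) k ((!) \<alpha>) ((!) \<beta>)"
  by (simp add: sub_mat_def minor_def)

lemma nontrivial_minors_signed: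
  assumes A: "A \<in> carrier_mat m n" and stair: "type1_staircase A \<or> type2_staircase A"
    and sgn: "\<And>k. 1 \<le> k \<Longrightarrow> k \<le> N \<Longrightarrow> e k = 1 \<or> e k = - 1"
    and cons: "\<And>k u v. 1 \<le> k \<Longrightarrow> k \<le> N \<Longrightarrow> u + k \<le> m \<Longrightarrow> v + k \<le> n \<Longrightarrow>
      nontrivial (\<lambda>i j. A $$ (i, j)) k ((+) u) ((+) v) \<Longrightarrow>
      0 < e k * minor (\<lambda>i j. A $$ (i, j)) k ((+) u) ((+) v)"
    and k: "1 \<le> k" "k \<le> N"
    and f: "index_seq k m f" and g: "index_seq k n g" and nt: "nontrivial (\<lambda>i j. A $$ (i, j)) k f g"
  shows "0 < e k * minor (\<lambda>i j. A $$ (i, j)) k f g"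
  using stair
proof
  assume "type1_staircase A"
  then interpret staircase "\<lambda>i j. A $$ (i, j)" m n
    by (rule staircase_type1[OF A])
  interpret signed_staircase "\<lambda>i j. A $$ (i, j)" m n e N
    by unfold_locales (fact sgn cons)+
  show ?thesis
    by (rule sign_okD[OF all_nontrivial_minors_signed[OF k] f g nt])
next
  assume type2: "type2_staircase A"
  \<comment> \<open>\<open>?a\<close> is the rectangle spanned by the submatrix, re-indexed from 0;
    its consecutive minors are consecutive minors of \<open>A\<close>.\<close>
  let ?u = "f 0" and ?v = "g 0" and ?l = "k - 1"
  let ?a = "\<lambda>i j. A $$ (?u + i, ?v + j)"
  let ?m = "Suc (f ?l - ?u)" and ?n = "Suc (g ?l - ?v)"
  have l: "?l < k" using k by simp
  have ends: "?u \<le> f ?l" "f ?l < m" "?v \<le> g ?l" "g ?l < n"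
    using index_seq_leD[OF f _ l] index_seq_leD[OF g _ l] index_seq_boundD[OF f l]
      index_seq_boundD[OF g l] by auto
  have nonzero: "?a i j \<noteq> 0" if "i < ?m" "j < ?n" for i j
  proof -
    have "?u + i \<le> f ?l" "?v + j \<le> g ?l"
      using that ends by linarith+
    then show ?thesis
      using type2_rectangle_nonzero[OF A type2, of ?u ?v "f ?l" "g ?l" "?u + i" "?v + j"] nt k l ends
      by (simp add: nontrivial_def)
  qed
  interpret signed_staircase ?a ?m ?n e N
  proof
    show "0 < e k * minor ?a k ((+) u) ((+) v)"
      if "1 \<le> k" "k \<le> N" "u + k \<le> ?m" "v + k \<le> ?n" "nontrivial ?a k ((+) u) ((+) v)" for k u v
    proof -
      have "0 < e k * minor (\<lambda>i j. A $$ (i, j)) k ((+) (?u + u)) ((+) (?v + v))"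
      proof (rule cons[OF that(1,2)])
        show "?u + u + k \<le> m" "?v + v + k \<le> n"
          using that(3,4) ends by linarith+
      qed (use that(5) in \<open>simp add: nontrivial_def add.assoc\<close>)
      also have "minor (\<lambda>i j. A $$ (i, j)) k ((+) (?u + u)) ((+) (?v + v)) = minor ?a k ((+) u) ((+) v)"
        by (rule minor_cong) (simp add: add.assoc)
      finally show ?thesis .
    qed
    show "?a i i \<noteq> 0" if "i < ?m" "i < ?n" for i
      using nonzero that by blast
    \<comment> \<open>Both zero conditions hold vacuously, since the rectangle contains no
      zero.\<close>
    show "?a k l = 0" if "k < ?m" "j < ?n" "j < i" "?a i j = 0" "i \<le> k" "l \<le> j" for k j i l
    proof -
      have "i < ?m" "j < ?n" using that by linarith+
      then show ?thesis using nonzero that(4) by blast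
    qed
    show "?a k l = 0" if "i < ?m" "l < ?n" "i < j" "?a i j = 0" "k \<le> i" "j \<le> l" for i l j k
    proof -
      have "i < ?m" "j < ?n" using that by linarith+
      then show ?thesis using nonzero that(4) by blast
    qed
    show "e k = 1 \<or> e k = - 1" if "1 \<le> k" "k \<le> N" for k
      using sgn that .
  qed
  have ge: "?u \<le> f i" "?v \<le> g i" if "i < k" for i
    using index_seq_leD[OF f, of 0 i] index_seq_leD[OF g, of 0 i] that by auto
  have idx: "index_seq k ?m (\<lambda>i. f i - ?u)" "index_seq k ?n (\<lambda>i. g i - ?v)"
    by (rule index_seqI; use ge index_seq_lessD[OF f] index_seq_lessD[OF g] in \<open>simp add: diff_less_mono\<close>)+
  have nt': "nontrivial ?a k (\<lambda>i. f i - ?u) (\<lambda>i. g i - ?v)"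
    using nt ge by (simp add: nontrivial_def)
  have "0 < e k * minor ?a k (\<lambda>i. f i - ?u) (\<lambda>i. g i - ?v)"
    by (rule sign_okD[OF all_nontrivial_minors_signed[OF k] idx nt'])
  also have "minor ?a k (\<lambda>i. f i - ?u) (\<lambda>i. g i - ?v) = minor (\<lambda>i j. A $$ (i, j)) k f g"
    by (rule minor_cong) (use ge in simp)
  finally show ?thesis .
qed

theorem theorem3p9:
  fixes A :: "real mat" and \<epsilon> :: "real vec" and m n r :: nat
  assumes "A \<in> carrier_mat m n"
    and "m \<ge> n"
    and "vec_space.rank m A = r" and "r = min m n"
    and "is_signature r \<epsilon>"
  shows "ASSR A \<epsilon> \<longleftrightarrow>
    (type1_staircase A \<or> type2_staircase A) \<and>
    (\<forall>k \<in> {1..n}. \<forall>\<alpha> \<in> Q0 k m. \<forall>\<beta> \<in> Q0 k n.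
       nontrivial_sub_mat A \<alpha> \<beta> \<longrightarrow> \<epsilon> $ (k - 1) * det (sub_mat A \<alpha> \<beta>) > 0)"
proof -
  let ?a = "\<lambda>i j. A $$ (i, j)" and ?e = "\<lambda>k. \<epsilon> $ (k - 1)"
  have r: "r = n" "min m n = n" using assms by auto
  have dims: "dim_row A = m" "dim_col A = n" using assms(1) by auto
  \<comment> \<open>Rank and signature are given, so the two sides of the claim differ only in
    \<open>Q\<close> versus \<open>Q0\<close>.\<close>
  have ASSR: "ASSR A \<epsilon> \<longleftrightarrow> (type1_staircase A \<or> type2_staircase A) \<and>
      (\<forall>k \<in> {1..n}. \<forall>\<alpha> \<in> Q k m. \<forall>\<beta> \<in> Q k n.
         nontrivial_sub_mat A \<alpha> \<beta> \<longrightarrow> \<epsilon> $ (k - 1) * det (sub_mat A \<alpha> \<beta>) > 0)"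
    using assms(3,5) by (simp add: ASSR_def dims r)
  have "\<epsilon> $ (k - 1) * det (sub_mat A \<alpha> \<beta>) > 0"
    if stair: "type1_staircase A \<or> type2_staircase A"
      and cons: "\<forall>k \<in> {1..n}. \<forall>\<alpha> \<in> Q0 k m. \<forall>\<beta> \<in> Q0 k n.
        nontrivial_sub_mat A \<alpha> \<beta> \<longrightarrow> \<epsilon> $ (k - 1) * det (sub_mat A \<alpha> \<beta>) > 0"
      and k: "k \<in> {1..n}" and \<alpha>: "\<alpha> \<in> Q k m" and \<beta>: "\<beta> \<in> Q k n" and nt: "nontrivial_sub_mat A \<alpha> \<beta>"
    for k \<alpha> \<beta>
  proof -
    have len: "length \<alpha> = k" "length \<beta> = k" using \<alpha> \<beta> by (auto simp: Q_def)
    have "0 < ?e k * minor ?a k ((!) \<alpha>) ((!) \<beta>)"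
    proof (rule nontrivial_minors_signed[OF assms(1) stair, of n])
      show "?e k = 1 \<or> ?e k = - 1" if "1 \<le> k" "k \<le> n" for k
        using assms(5) that r by (auto simp: is_signature_def)
      show "0 < ?e k * minor ?a k ((+) u) ((+) v)"
        if "1 \<le> k" "k \<le> n" "u + k \<le> m" "v + k \<le> n" "nontrivial ?a k ((+) u) ((+) v)" for k u v
      proof -
        have "nontrivial_sub_mat A [u..<u + k] [v..<v + k]"
          using that(5) by (simp add: nontrivial_sub_mat_def nontrivial_def)
        moreover have "k \<in> {1..n}" "[u..<u + k] \<in> Q0 k m" "[v..<v + k] \<in> Q0 k n"
          using that upt_Q0 by auto
        ultimately have "0 < ?e k * det (sub_mat A [u..<u + k] [v..<v + k])"
          using cons by blast
        also have "det (sub_mat A [u..<u + k] [v..<v + k]) = minor ?a k ((+) u) ((+) v)"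
          by (subst det_sub_mat[where k = k]) (auto intro: minor_cong)
        finally show ?thesis .
      qed
      show "nontrivial ?a k ((!) \<alpha>) ((!) \<beta>)"
        using nt nontrivial_sub_mat_eq[OF len(1)] by blast
    qed (use k index_seq_Q[OF \<alpha>] index_seq_Q[OF \<beta>] in simp_all)
    then show ?thesis
      unfolding det_sub_mat[OF len] .
  qed
  moreover have "Q0 k m \<subseteq> Q k m" "Q0 k n \<subseteq> Q k n" for k
    by (auto simp: Q0_def)
  ultimately show ?thesis
    unfolding ASSR by blast
qed

end
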